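(* Let $\{P_\theta:\theta\in\Theta\}$ be a family of probability measures with a discrete mixture representation $P_\theta=\sum_{i\in E}w_\theta(i)\,Q_i$, $\theta\in\Theta$, and suppose that this representation holds in some Banach space $(\mathbb{B},\|\cdot\|)$. Suppose further that: (C) the function $\theta\mapsto w_\theta$ on $\Theta$ with values in $(\ell_1(E),\|\cdot\|_1)$ is continuous; (B) the set $\{Q_i:i\in E\}$ is bounded in $(\mathbb{B},\|\cdot\|)$. Then the function $\theta\mapsto P_\theta$ on $\Theta$ with values in $\mathbb{B}$ is continuous.
   Context: $\Theta$ is a subset of $\mathbb{R}^d$ for some $d\ge1$ (with its usual topology). $E$ is a finite or countably infinite set, the $Q_i$, $i\in E$, are probability measures, and for each $\theta\in\Theta$, $w_\theta=(w_\theta(i))_{i\in E}$ is a probability mass function on $E$. The space $\ell_1(E)=\{(a_i)_{i\in E}\in\mathbb{R}^E:\|a\|_1:=\sum_{i\in E}|a_i|<\infty\}$ is equipped with the norm $\|\cdot\|_1$. That the representation holds in the Banach space $(\mathbb{B},\|\cdot\|)$ means that all $P_\theta$ and all $Q_i$ are regarded (for example via their densities with respect to a dominating measure) as elements of $\mathbb{B}$, and that $P_\theta=\sum_{i\in E}w_\theta(i)\,Q_i$ for every $\theta\in\Theta$, with the series converging in the norm of $\mathbb{B}$. *)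

theory Defs
  imports "HOL-Probability.Probability"
begin

text \<open>\<open>\<real>\<^sup>E\<close> is \<open>E \<rightarrow>\<^sub>E UNIV\<close>, so that an element is determined by its values on \<open>E\<close>.\<close>

definition l1_space :: "'i set \<Rightarrow> ('i \<Rightarrow> real) set" where
  "l1_space E = {a \<in> E \<rightarrow>\<^sub>E UNIV. (\<lambda>i. \<bar>a i\<bar>) summable_on E}"

definition l1_norm :: "'i set \<Rightarrow> ('i \<Rightarrow> real) \<Rightarrow> real" where
  "l1_norm E a = (\<Sum>\<^sub>\<infinity>i\<in>E. \<bar>a i\<bar>)"

definition l1_dist :: "'i set \<Rightarrow> ('i \<Rightarrow> real) \<Rightarrow> ('i \<Rightarrow> real) \<Rightarrow> real" where
  "l1_dist E a b = l1_norm E (\<lambda>i. a i - b i)"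

definition l1_topology :: "'i set \<Rightarrow> ('i \<Rightarrow> real) topology" where
  "l1_topology E = Metric_space.mtopology (l1_space E) (l1_dist E)"

lemma l1_diff_summable:
  assumes "a \<in> l1_space E" "b \<in> l1_space E"
  shows "(\<lambda>i. \<bar>a i - b i\<bar>) summable_on E"
proof (rule summable_on_comparison_test)
  show "(\<lambda>i. \<bar>a i\<bar> + \<bar>b i\<bar>) summable_on E"
    using assms by (intro summable_on_add) (auto simp: l1_space_def)
qed auto

lemma Metric_space_l1: "Metric_space (l1_space E) (l1_dist E)"
proof
  fix a b c :: "'a \<Rightarrow> real"
  show "0 \<le> l1_dist E a b"
    by (simp add: l1_dist_def l1_norm_def infsum_nonneg)
  show "l1_dist E a b = l1_dist E b a"
    by (simp add: l1_dist_def l1_norm_def abs_minus_commute)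
  assume a: "a \<in> l1_space E" and b: "b \<in> l1_space E"
  show "l1_dist E a b = 0 \<longleftrightarrow> a = b"
  proof
    assume "l1_dist E a b = 0"
    then have "\<bar>a i - b i\<bar> = 0" if "i \<in> E" for i
      using l1_diff_summable[OF a b] that
      by (intro nonneg_infsum_le_0D[where A = E and f = "\<lambda>i. \<bar>a i - b i\<bar>"])
        (auto simp: l1_dist_def l1_norm_def)
    then show "a = b"
      using a b by (intro PiE_ext[where k = E]) (auto simp: l1_space_def)
  qed (simp add: l1_dist_def l1_norm_def)
  assume c: "c \<in> l1_space E"
  have "l1_dist E a c \<le> (\<Sum>\<^sub>\<infinity>i\<in>E. \<bar>a i - b i\<bar> + \<bar>b i - c i\<bar>)"
    unfolding l1_dist_def l1_norm_def
    using l1_diff_summable a b c by (intro infsum_mono summable_on_add) auto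
  also have "\<dots> = l1_dist E a b + l1_dist E b c"
    unfolding l1_dist_def l1_norm_def
    using l1_diff_summable a b c by (intro infsum_add) auto
  finally show "l1_dist E a c \<le> l1_dist E a b + l1_dist E b c" .
qed

definition prob_mass_function_on :: "'i set \<Rightarrow> ('i \<Rightarrow> real) \<Rightarrow> bool" where
  "prob_mass_function_on E p \<longleftrightarrow> (\<forall>i\<in>E. 0 \<le> p i) \<and> (p has_sum 1) E"

definition discrete_mixture ::
  "'s measure \<Rightarrow> 't set \<Rightarrow> 'i set \<Rightarrow> ('t \<Rightarrow> 's measure) \<Rightarrow> ('t \<Rightarrow> 'i \<Rightarrow> real) \<Rightarrow> ('i \<Rightarrow> 's measure) \<Rightarrow> bool"
where
  "discrete_mixture M \<Theta> E P w Q \<longleftrightarrow>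
     (\<forall>i\<in>E. Q i \<in> space (prob_algebra M)) \<and>
     (\<forall>\<theta>\<in>\<Theta>. P \<theta> \<in> space (prob_algebra M) \<and>
        prob_mass_function_on E (w \<theta>) \<and>
        (\<forall>A\<in>sets M. ((\<lambda>i. w \<theta> i * measure (Q i) A) has_sum measure (P \<theta>) A) E))"

text \<open>The map \<open>\<iota>\<close> says how measures are regarded as elements of the Banach space (for instance
  via densities). Nothing is required of it away from the measures \<open>P \<theta>\<close> and \<open>Q i\<close>.\<close>

definition mixture_holds_in ::
  "('s measure \<Rightarrow> 'b::banach) \<Rightarrow> 't set \<Rightarrow> 'i set \<Rightarrow> ('t \<Rightarrow> 's measure) \<Rightarrow> ('t \<Rightarrow> 'i \<Rightarrow> real)
    \<Rightarrow> ('i \<Rightarrow> 's measure) \<Rightarrow> bool"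
where
  "mixture_holds_in \<iota> \<Theta> E P w Q \<longleftrightarrow>
     (\<forall>\<theta>\<in>\<Theta>. ((\<lambda>i. w \<theta> i *\<^sub>R \<iota> (Q i)) has_sum \<iota> (P \<theta>)) E)"

end

theory Submission
  imports Defs
begin

text \<open>For a family \<open>v\<close> of vectors with norms at most \<open>K\<close>, the triangle inequality shows that the
  linear map from a weight sequence \<open>a\<close> to \<open>\<Sum>\<^sub>i a\<^sub>i v\<^sub>i\<close> has operator norm at most \<open>K\<close> with
  respect to the \<open>\<ell>\<^sub>1\<close> norm (\<open>norm_weighted_sum_le\<close>). Linearity makes this a Lipschitz bound
  (\<open>weighted_sum_lipschitz_l1\<close>). With \<open>v\<^sub>i = \<iota> (Q\<^sub>i)\<close>, bounded by (B), the map
  \<open>\<theta> \<mapsto> \<iota> (P\<^sub>\<theta>)\<close> is therefore the continuous map \<open>\<theta> \<mapsto> w\<^sub>\<theta>\<close> of (C) followed by a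
  \<open>K\<close>-Lipschitz map.\<close>

lemma norm_weighted_sum_le:
  fixes v :: "'i \<Rightarrow> 'b::real_normed_vector"
  assumes sum: "((\<lambda>i. a i *\<^sub>R v i) has_sum x) E"
    and summable: "(\<lambda>i. \<bar>a i\<bar>) summable_on E"
    and bound: "\<And>i. i \<in> E \<Longrightarrow> norm (v i) \<le> K"
  shows "norm x \<le> K * l1_norm E a"
proof (rule norm_infsum_le[OF sum])
  have "((\<lambda>i. \<bar>a i\<bar>) has_sum l1_norm E a) E"
    unfolding l1_norm_def using summable by (rule has_sum_infsum)
  then show "((\<lambda>i. K * \<bar>a i\<bar>) has_sum (K * l1_norm E a)) E"
    by (rule has_sum_cmult_right)
  show "norm (a i *\<^sub>R v i) \<le> K * \<bar>a i\<bar>" if "i \<in> E" for i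
    using mult_right_mono[OF bound[OF that] abs_ge_zero[of "a i"]] by (simp add: mult.commute)
qed

text \<open>Only the values on \<open>E\<close> enter the sums, while the points of \<open>l1_space E\<close> are extensional; hence
  the restrictions.\<close>

lemma weighted_sum_lipschitz_l1:
  fixes v :: "'i \<Rightarrow> 'b::real_normed_vector"
  assumes "((\<lambda>i. a i *\<^sub>R v i) has_sum x) E" "((\<lambda>i. b i *\<^sub>R v i) has_sum y) E"
    and "restrict a E \<in> l1_space E" "restrict b E \<in> l1_space E"
    and "\<And>i. i \<in> E \<Longrightarrow> norm (v i) \<le> K"
  shows "norm (x - y) \<le> K * l1_dist E (restrict a E) (restrict b E)"
  unfolding l1_dist_def
proof (rule norm_weighted_sum_le)
  have "((\<lambda>i. a i *\<^sub>R v i - b i *\<^sub>R v i) has_sum (x - y)) E"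
    using has_sum_add[OF assms(1), of "\<lambda>i. - (b i *\<^sub>R v i)" "- y"] assms(2)
    by (simp add: has_sum_uminus)
  then show "((\<lambda>i. (restrict a E i - restrict b E i) *\<^sub>R v i) has_sum (x - y)) E"
    by (simp add: scaleR_diff_left cong: has_sum_cong)
  show "(\<lambda>i. \<bar>restrict a E i - restrict b E i\<bar>) summable_on E"
    using assms(3,4) by (rule l1_diff_summable)
qed (use assms(5) in auto)

theorem proposition6:
  fixes \<Theta> :: "(real ^ 'd) set"
    and E :: "'i set"
    and M :: "'s measure"
    and P :: "real ^ 'd \<Rightarrow> 's measure"
    and w :: "real ^ 'd \<Rightarrow> 'i \<Rightarrow> real"
    and Q :: "'i \<Rightarrow> 's measure"
    and \<iota> :: "'s measure \<Rightarrow> 'b::banach"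
  assumes "countable E"
    and "discrete_mixture M \<Theta> E P w Q"
    and "mixture_holds_in \<iota> \<Theta> E P w Q"
    and C: "continuous_map (top_of_set \<Theta>) (l1_topology E) (\<lambda>\<theta>. restrict (w \<theta>) E)"
    and B: "bounded ((\<lambda>i. \<iota> (Q i)) ` E)"
  shows "continuous_on \<Theta> (\<lambda>\<theta>. \<iota> (P \<theta>))"
proof -
  interpret l1: Metric_space "l1_space E" "l1_dist E"
    by (rule Metric_space_l1)
  obtain K where "0 < K" and K: "\<And>i. i \<in> E \<Longrightarrow> norm (\<iota> (Q i)) \<le> K"
    using B by (auto simp: bounded_pos)
  have sums: "((\<lambda>i. w \<theta> i *\<^sub>R \<iota> (Q i)) has_sum \<iota> (P \<theta>)) E" if "\<theta> \<in> \<Theta>" for \<theta>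
    using assms(3) that by (simp add: mixture_holds_in_def)
  have "continuous_map (top_of_set \<Theta>) Met_TC.mtopology (\<lambda>\<theta>. \<iota> (P \<theta>))"
    unfolding Met_TC.continuous_map_to_metric
  proof (intro strip)
    fix \<theta> \<epsilon> assume "\<theta> \<in> topspace (top_of_set \<Theta>)" and "0 < (\<epsilon>::real)"
    \<comment> \<open>A distance \<open>\<epsilon> / K\<close> between the weights becomes \<open>\<epsilon>\<close> under a \<open>K\<close>-Lipschitz map.\<close>
    then obtain U where U: "openin (top_of_set \<Theta>) U" "\<theta> \<in> U"
      and near: "\<And>\<eta>. \<eta> \<in> U \<Longrightarrow> restrict (w \<eta>) E \<in> l1.mball (restrict (w \<theta>) E) (\<epsilon> / K)"
      using C \<open>0 < K\<close> unfolding l1_topology_def l1.continuous_map_to_metric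
      by (meson divide_pos_pos)
    have "\<iota> (P \<eta>) \<in> Met_TC.mball (\<iota> (P \<theta>)) \<epsilon>" if "\<eta> \<in> U" for \<eta>
    proof -
      have "\<theta> \<in> \<Theta>" "\<eta> \<in> \<Theta>"
        using U that openin_imp_subset by blast+
      then have "norm (\<iota> (P \<theta>) - \<iota> (P \<eta>)) \<le> K * l1_dist E (restrict (w \<theta>) E) (restrict (w \<eta>) E)"
        using near[OF that] by (intro weighted_sum_lipschitz_l1[OF sums sums _ _ K]) auto
      also have "\<dots> < \<epsilon>"
        using near[OF that] \<open>0 < K\<close> by (simp add: pos_less_divide_eq mult.commute)
      finally show ?thesis
        by (simp add: dist_norm)
    qed
    with U show "\<exists>U. openin (top_of_set \<Theta>) U \<and> \<theta> \<in> U \<and> (\<forall>\<eta>\<in>U. \<iota> (P \<eta>) \<in> Met_TC.mball (\<iota> (P \<theta>)) \<epsilon>)"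
      by blast
  qed
  then show ?thesis
    by simp
qed

end
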